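(* Let $\zeta>1$ be a transcendental real number and let $\mathscr{M}_{\zeta}$ be the set of all $\alpha\in\mathbb{R}$ such that $\Vert\alpha\zeta^{n}\Vert\to 0$ as $n\to\infty$. Then either $\mathscr{M}_{\zeta}=\{0\}$, or $\mathscr{M}_{\zeta}$ is not finitely generated as a $\mathbb{Z}$-module.
   Context: For $x\in\mathbb{R}$, $\Vert x\Vert$ denotes the distance from $x$ to the nearest integer. $\mathscr{M}_{\zeta}$ is a $\mathbb{Z}$-module (closed under integer linear combinations). *)

theory Defs
  imports Complex_Main "HOL-Computational_Algebra.Polynomial"
begin

definition dist_nearest_int :: "real \<Rightarrow> real" where
  "dist_nearest_int x = \<bar>x - of_int (round x)\<bar>"

definition M_set :: "real \<Rightarrow> real set" where
  "M_set \<zeta> = {\<alpha>. (\<lambda>n. dist_nearest_int (\<alpha> * \<zeta> ^ n)) \<longlonglongrightarrow> 0}"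

global_interpretation int_module: module "\<lambda>(k::int) (x::real). of_int k * x"
  by unfold_locales (simp_all add: algebra_simps)

definition fin_gen_int_module :: "real set \<Rightarrow> bool" where
  "fin_gen_int_module M \<longleftrightarrow> (\<exists>S. finite S \<and> int_module.span S = M)"

lemma dist_nearest_int_le: "dist_nearest_int x \<le> \<bar>x - of_int m\<bar>"
  unfolding dist_nearest_int_def by (rule round_diff_minimal)

lemma dist_nearest_int_add: "dist_nearest_int (x + y) \<le> dist_nearest_int x + dist_nearest_int y"
  using dist_nearest_int_le[of "x + y" "round x + round y"]
  unfolding dist_nearest_int_def by simp

lemma dist_nearest_int_scale:
  "dist_nearest_int (of_int k * x) \<le> \<bar>of_int k\<bar> * dist_nearest_int x"
  using dist_nearest_int_le[of "of_int k * x" "k * round x"]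
  unfolding dist_nearest_int_def by (simp flip: abs_mult add: right_diff_distrib)

lemma M_set_submodule: "int_module.subspace (M_set \<zeta>)"
proof (rule int_module.subspaceI)
  have nn: "dist_nearest_int x \<ge> 0" for x by (simp add: dist_nearest_int_def)
  show "0 \<in> M_set \<zeta>" by (simp add: M_set_def dist_nearest_int_def)
  show "x + y \<in> M_set \<zeta>" if "x \<in> M_set \<zeta>" "y \<in> M_set \<zeta>" for x y
  proof -
    have "(\<lambda>n. dist_nearest_int (x * \<zeta> ^ n) + dist_nearest_int (y * \<zeta> ^ n)) \<longlonglongrightarrow> 0"
      using that tendsto_add[of _ 0 _ _ 0] by (auto simp: M_set_def)
    then show ?thesis
      unfolding M_set_def mem_Collect_eq
      by (rule tendsto_sandwich[OF _ _ tendsto_const, rotated 2])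
        (use nn dist_nearest_int_add in \<open>auto simp: distrib_right\<close>)
  qed
  show "of_int k * x \<in> M_set \<zeta>" if "x \<in> M_set \<zeta>" for k :: int and x
  proof -
    have "(\<lambda>n. \<bar>of_int k\<bar> * dist_nearest_int (x * \<zeta> ^ n)) \<longlonglongrightarrow> 0"
      using that by (auto simp: M_set_def intro: tendsto_mult_right_zero)
    then show ?thesis
      unfolding M_set_def mem_Collect_eq
      by (rule tendsto_sandwich[OF _ _ tendsto_const, rotated 2])
        (use nn dist_nearest_int_scale in \<open>auto simp: mult.assoc\<close>)
  qed
qed

end

(* The module is stable under multiplication by zeta. If it were finitely generated, then for
   alpha \<noteq> 0 in it the numbers alpha * zeta^i would all lie in one finite-dimensional rational
   vector space, and a rational linear relation among them makes zeta algebraic. *)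
theory Submission
  imports Defs
begin

lemma vector_space_real_over_rat: "vector_space (\<lambda>(q::rat) (x::real). of_rat q * x)"
  by unfold_locales (simp_all add: algebra_simps of_rat_add of_rat_mult)

text \<open>Multiplying \<alpha> by \<open>\<zeta> ^ i\<close> only shifts the sequence of distances
  by \<open>i\<close> places, which does not affect its limit.\<close>

lemma M_set_mult_power:
  assumes "\<alpha> \<in> M_set \<zeta>"
  shows "\<alpha> * \<zeta> ^ i \<in> M_set \<zeta>"
proof -
  have "(\<lambda>n. dist_nearest_int (\<alpha> * \<zeta> ^ (n + i))) \<longlonglongrightarrow> 0"
    using assms unfolding M_set_def mem_Collect_eq by (rule LIMSEQ_ignore_initial_segment)
  then show ?thesis
    by (simp add: M_set_def power_add mult_ac)
qed

text \<open>Linear dependence concerns sets, so \<open>inj\<close> and \<alpha> \<noteq> 0 are there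
  to keep the products \<open>\<alpha> * \<zeta> ^ i\<close> distinct: without this, too few vectors
  might remain to force a relation.\<close>

lemma algebraic_if_powers_in_fin_gen_int_module:
  fixes \<alpha> \<zeta> :: real
  assumes "\<alpha> \<noteq> 0" and inj: "inj (\<lambda>i::nat. \<zeta> ^ i)"
    and "fin_gen_int_module M" and powers: "\<And>i. \<alpha> * \<zeta> ^ i \<in> M"
  shows "algebraic \<zeta>"
proof -
  interpret Q: vector_space "\<lambda>(q::rat) (x::real). of_rat q * x"
    by (rule vector_space_real_over_rat)
  from assms(3) obtain S where S: "finite S" "int_module.span S = M"
    unfolding fin_gen_int_module_def by blast
  \<comment> \<open>A rational subspace is in particular closed under integer multiples, so it is a
    submodule containing \<open>S\<close>.\<close>
  have "int_module.span S \<subseteq> Q.span S"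
  proof (rule int_module.span_minimal)
    show "int_module.subspace (Q.span S)"
    proof (rule int_module.subspaceI)
      show "of_int c * x \<in> Q.span S" if "x \<in> Q.span S" for c :: int and x
        using Q.span_scale[OF that, of "of_int c"] by simp
    qed (auto intro: Q.span_add Q.span_zero)
  qed (rule Q.span_superset)
  with S powers have in_span: "\<alpha> * \<zeta> ^ i \<in> Q.span S" for i
    by blast
  define n where "n = card S"
  \<comment> \<open>The exponents run from 0 to \<open>n\<close>, giving one vector more than
    \<open>S\<close> has elements.\<close>
  define T where "T = (\<lambda>i. \<alpha> * \<zeta> ^ i) ` {..n}"
  have inj_T: "inj_on (\<lambda>i. \<alpha> * \<zeta> ^ i) {..n}"
    using inj \<open>\<alpha> \<noteq> 0\<close> by (auto simp: inj_on_def)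
  have "card T = Suc n"
    unfolding T_def by (simp add: card_image[OF inj_T])
  moreover have "T \<subseteq> Q.span S"
    using in_span by (auto simp: T_def)
  ultimately have "Q.dependent T"
    using Q.independent_span_bound[OF S(1), of T] by (auto simp: n_def)
  moreover have "finite T"
    by (simp add: T_def)
  ultimately obtain u where u: "\<exists>v\<in>T. u v \<noteq> 0" "(\<Sum>v\<in>T. of_rat (u v) * v) = 0"
    by (auto simp: Q.dependent_finite)
  \<comment> \<open>The relation \<open>u\<close> is indexed by elements of \<open>T\<close>;
    \<open>c\<close> reindexes it by exponents. Its values are rational but typed as reals, since
    \<open>p\<close> has to be a real polynomial with coefficients in \<rat>.\<close>
  define c where "c i = (of_rat (u (\<alpha> * \<zeta> ^ i)) :: real)" for i
  define p where "p = (\<Sum>i\<le>n. monom (c i) i)"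
  have coeff_p: "coeff p i = (if i \<le> n then c i else 0)" for i
    by (simp add: p_def coeff_sum)
  \<comment> \<open>The relation is \<alpha> times a polynomial value at \<zeta>, so the nonzero
    factor \<alpha> cancels.\<close>
  have "\<alpha> * poly p \<zeta> = (\<Sum>i\<le>n. c i * (\<alpha> * \<zeta> ^ i))"
    by (simp add: p_def poly_sum poly_monom sum_distrib_left mult_ac)
  also have "\<dots> = 0"
    using u(2) by (simp add: T_def sum.reindex[OF inj_T] c_def)
  finally have "poly p \<zeta> = 0"
    using \<open>\<alpha> \<noteq> 0\<close> by simp
  moreover obtain i where "i \<le> n" "c i \<noteq> 0"
    using u(1) by (auto simp: T_def c_def)
  then have "p \<noteq> 0"
    using coeff_p[of i] by auto
  moreover have "coeff p i \<in> \<rat>" for i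
    by (simp add: coeff_p c_def)
  ultimately show ?thesis
    unfolding algebraic_altdef by blast
qed

theorem theorem1p7:
  fixes \<zeta> :: real
  assumes "\<zeta> > 1" and "\<not> algebraic \<zeta>"
  shows "M_set \<zeta> = {0} \<or> \<not> fin_gen_int_module (M_set \<zeta>)"
proof (rule disjCI)
  assume "\<not> \<not> fin_gen_int_module (M_set \<zeta>)"
  then have fg: "fin_gen_int_module (M_set \<zeta>)"
    by simp
  have inj: "inj (\<lambda>i::nat. \<zeta> ^ i)"
    using assms(1) by (auto simp: inj_def)
  \<comment> \<open>A nonzero \<alpha> would make \<zeta> algebraic, against the assumption.\<close>
  have "\<alpha> = 0" if "\<alpha> \<in> M_set \<zeta>" for \<alpha>
    using algebraic_if_powers_in_fin_gen_int_module[OF _ inj fg M_set_mult_power[OF that]] assms(2)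
    by blast
  moreover have "0 \<in> M_set \<zeta>"
    using int_module.subspace_0[OF M_set_submodule] .
  ultimately show "M_set \<zeta> = {0}"
    by blast
qed

end
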